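(* Let $0<q<1$, $\alpha>-1$ and $c\le 0$, and let $$w(x)=\frac{|x|^\alpha\,(q^2x^2;q^2)_\infty\,(cq^2x^2;q^2)_\infty}{(1-q^4)^{\alpha/4}}$$ on the $q$-exponential lattice $L=\{\pm q^k : k=0,1,2,\ldots\}$. Let $(p_n)_{n\ge0}$ be the orthonormal polynomials with positive leading coefficients for $w$ with respect to the $q$-integral on $[-1,1]$, and let $a_n>0$ $(n\ge 1)$ be their recurrence coefficients. Set $y_0=0$ and $y_n=a_n^2q^{1-n}$ for $n\ge1$. Then for every $n\ge1$ $$q^{n-\alpha}\left(-cy_ny_{n+1}+q^\alpha\right)\left(-cy_ny_{n-1}+q^\alpha\right)=\begin{cases}(q^\alpha-y_n)(q^\alpha-cy_n)q^{-\alpha}, & n\text{ even},\\ (1-y_n)(1-cy_n), & n \text{ odd}.\end{cases}$$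
   Context: $(a;q)_\infty=\prod_{j=0}^\infty(1-aq^j)$. The $q$-integral is $$\int_{-1}^1 f(x)\,d_qx=(1-q)\sum_{k=0}^\infty f(q^k)q^k+(1-q)\sum_{k=0}^\infty f(-q^k)q^k .$$ The orthonormal polynomials $p_n$ (of degree $n$, with positive leading coefficient) are determined by $\int_{-1}^1p_n(x)p_m(x)w(x)\,d_qx=\delta_{mn}$ for $m,n\ge0$. Since $w$ is even, they satisfy $p_n(-x)=(-1)^np_n(x)$ and a three-term recurrence $xp_n(x)=a_{n+1}p_{n+1}(x)+a_np_{n-1}(x)$ for $n\ge0$, with $p_{-1}=0$, which defines the recurrence coefficients $a_n>0$ ($n\ge1$). *)

theory Defs
  imports "HOL-Analysis.Analysis" "HOL-Computational_Algebra.Polynomial"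
begin

definition qpoch_inf :: "real \<Rightarrow> real \<Rightarrow> real" where
  "qpoch_inf a q = (\<Prod>j. 1 - a * q ^ j)"

text \<open>The \<open>q\<close>-integral over \<open>[-1, 1]\<close>. It only uses the values of the integrand on the lattice
  of all \<open>q ^ k\<close> and \<open>- (q ^ k)\<close>, so the value of a weight elsewhere is irrelevant.\<close>

definition q_integral :: "real \<Rightarrow> (real \<Rightarrow> real) \<Rightarrow> real" where
  "q_integral q f =
     (1 - q) * (\<Sum>k. f (q ^ k) * q ^ k) + (1 - q) * (\<Sum>k. f (- (q ^ k)) * q ^ k)"

definition qweight :: "real \<Rightarrow> real \<Rightarrow> real \<Rightarrow> real \<Rightarrow> real" where
  "qweight q \<alpha> c x =
     \<bar>x\<bar> powr \<alpha> * qpoch_inf (q\<^sup>2 * x\<^sup>2) (q\<^sup>2) * qpoch_inf (c * q\<^sup>2 * x\<^sup>2) (q\<^sup>2)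
       / (1 - q ^ 4) powr (\<alpha> / 4)"

definition orthonormal_polys :: "real \<Rightarrow> (real \<Rightarrow> real) \<Rightarrow> (nat \<Rightarrow> real poly) \<Rightarrow> bool" where
  "orthonormal_polys q w p \<longleftrightarrow>
     (\<forall>n. degree (p n) = n \<and> lead_coeff (p n) > 0) \<and>
     (\<forall>m n. q_integral q (\<lambda>x. poly (p n) x * poly (p m) x * w x) = (if m = n then 1 else 0))"

text \<open>The case \<open>n = 0\<close> encodes the convention that \<open>p\<close> vanishes at index \<open>-1\<close>; the value
  \<open>a 0\<close> plays no role.\<close>

definition recurrence_coeffs :: "(nat \<Rightarrow> real poly) \<Rightarrow> (nat \<Rightarrow> real) \<Rightarrow> bool" where
  "recurrence_coeffs p a \<longleftrightarrow>
     (\<forall>n\<ge>1. a n > 0) \<and>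
     (\<forall>n. [:0, 1:] * p n =
        smult (a (n + 1)) (p (n + 1)) + (if n = 0 then 0 else smult (a n) (p (n - 1))))"

end

theory Submission
  imports Defs
begin

text \<open>
  The weight satisfies the \<open>q\<close>-Pearson equation \<open>w(x / q) = t \<sigma>(x) w(x)\<close> with \<open>t = q powr (- \<alpha>)\<close> and
  \<open>\<sigma>(x) = (1 - x^2) (1 - c x^2)\<close>. As \<open>\<sigma>\<close> vanishes at the end points of the lattice, the
  functional \<open>L f\<close>, the \<open>q\<close>-integral of \<open>f w\<close>, satisfies \<open>L (f (q x)) = (t / q) L (\<sigma> f)\<close>
  (lemma \<open>q_pearson_qweight\<close>). The recurrence is a consequence of this identity, so it is derived in a locale for an abstract functional \<open>L\<close>.

  Consider the matrix of the dilation \<open>f(x) \<mapsto> f(q x)\<close> in the basis \<open>p_n\<close>. It is triangular, and since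
  \<open>\<sigma>\<close> has degree 4 the Pearson equation makes it banded, with nonzero entries only at distance
  0, 2 and 4 from the diagonal. The two outer diagonals are explicit (\<open>dil_diag\<close>,
  \<open>dil_far\<close>), and only the middle one, called \<open>u\<close> after rescaling, is unknown. Dilation
  \<open>q\<close>-commutes with multiplication by \<open>x\<close> (\<open>dil_commute\<close>). Compared entry by entry, this gives
  two relations between \<open>u\<close> and \<open>y\<close> (\<open>u_step_near\<close>, \<open>u_step_far\<close>).

  Combined, the two relations say that an expression \<open>invar\<close>, affine in \<open>u\<close>, has
  period 2. Its value at 0 is \<open>1\<close>, by the commutation relation in the corner of the matrix; its value
  at 1 is \<open>t\<close>, by the Pearson equation for the squares of \<open>p_0\<close> and \<open>p_1\<close>.
  This determines \<open>u\<close> in terms of \<open>y\<close>; inserted into \<open>u_step_near\<close> it yields a third order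
  recurrence for \<open>y\<close>, which an induction integrates to the asserted second order one; the parity in
  the result is the parity of \<open>invar\<close>.
\<close>

section \<open>Orthonormal polynomials for a functional with a q-Pearson equation\<close>

text \<open>
  The recurrence has no term in \<open>p n\<close>, which expresses that the functional is even. Setting \<open>a 0 = 0\<close>
  makes it hold for \<open>n = 0\<close>, where \<open>n - 1\<close> truncates. The quartic in the Pearson equation is
  \<open>(1 - x^2) (1 - c x^2)\<close>.
\<close>

locale q_pearson_functional =
  fixes q t c :: real
    and L :: "real poly \<Rightarrow> real"
    and p :: "nat \<Rightarrow> real poly"
    and a :: "nat \<Rightarrow> real"
  assumes q_pos: "q > 0" and t_pos: "t > 0"
    and L_add: "L (f + g) = L f + L g"
    and L_smult: "L (smult k f) = k * L f"
    and degree_p: "degree (p n) = n"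
    and lead_p: "lead_coeff (p n) > 0"
    and ortho: "L (p n * p m) = (if n = m then 1 else 0)"
    and a_0: "a 0 = 0"
    and a_pos: "n \<ge> 1 \<Longrightarrow> a n > 0"
    and recurrence: "[:0, 1:] * p n = smult (a (Suc n)) (p (Suc n)) + smult (a n) (p (n - 1))"
    and pearson: "L (pcompose f [:0, q:]) = t / q * L ([:1, 0, - (1 + c), 0, c:] * f)"
begin

lemma L_diff: "L (f - g) = L f - L g"
  using L_add[of f "smult (-1) g"] L_smult[of "-1" g] by simp

lemma L_0: "L 0 = 0"
  using L_smult[of 0 0] by simp

lemma coeff_p_pos: "coeff (p n) n > 0"
  using lead_p[of n] by (simp add: degree_p)

text \<open>Bounding the degree by the vanishing of coefficients lets \<open>d = 0\<close> stand for the zero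
  polynomial, so that the induction removes one leading term at a time.\<close>

lemma L_p_times_lower:
  assumes "\<And>i. i \<ge> d \<Longrightarrow> coeff f i = 0" and "d \<le> n"
  shows "L (p n * f) = 0"
  using assms
proof (induction d arbitrary: f)
  case 0
  then have "f = 0" by (simp add: poly_eq_iff)
  then show ?case by (simp add: L_0)
next
  case (Suc d)
  define k where "k = coeff f d / coeff (p d) d"
  define g where "g = f - smult k (p d)"
  have "coeff g i = 0" if "i \<ge> d" for i
  proof (cases "i = d")
    case True
    then show ?thesis using coeff_p_pos[of d] by (simp add: g_def k_def)
  next
    case False
    then have "coeff (p d) i = 0"
      using that by (intro coeff_eq_0) (simp add: degree_p)
    moreover have "coeff f i = 0"
      using False that Suc.prems(1) by simp
    ultimately show ?thesis by (simp add: g_def)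
  qed
  then have "L (p n * g) = 0"
    using Suc.IH Suc.prems(2) by simp
  moreover have "p n * f = p n * g + smult k (p n * p d)"
    by (simp add: g_def algebra_simps)
  ultimately show ?case
    using Suc.prems(2) by (simp add: L_add L_smult ortho)
qed

lemma L_p_times:
  assumes "degree f \<le> n"
  shows "L (p n * f) = coeff f n / coeff (p n) n"
proof -
  define k where "k = coeff f n / coeff (p n) n"
  define g where "g = f - smult k (p n)"
  have "coeff g i = 0" if "i \<ge> n" for i
  proof (cases "i = n")
    case True
    then show ?thesis using coeff_p_pos[of n] by (simp add: g_def k_def)
  next
    case False
    then show ?thesis
      using that assms by (simp add: g_def coeff_eq_0 degree_p)
  qed
  then have "L (p n * g) = 0"
    by (intro L_p_times_lower[of n]) auto
  moreover have "p n * f = p n * g + smult k (p n * p n)"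
    by (simp add: g_def algebra_simps)
  ultimately show ?thesis
    by (simp add: L_add L_smult ortho k_def)
qed

lemma lead_p_step: "coeff (p n) n = a (Suc n) * coeff (p (Suc n)) (Suc n)"
proof -
  have "coeff ([:0, 1:] * p n) (Suc n) = coeff (p n) n"
    by simp
  moreover have "coeff (p (n - 1)) (Suc n) = 0"
    by (rule coeff_eq_0) (simp add: degree_p)
  ultimately show ?thesis
    using arg_cong[OF recurrence[of n], of "\<lambda>f. coeff f (Suc n)"] by simp
qed

text \<open>These are the matrix entries of the dilation by \<open>q\<close> in the orthonormal basis.\<close>

definition dil :: "nat \<Rightarrow> nat \<Rightarrow> real" where
  "dil n m = L (pcompose (p n) [:0, q:] * p m)"

lemma degree_dilated: "degree (pcompose (p n) [:0, q:]) = n"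
  using q_pos by (simp add: degree_pcompose degree_p)

lemma dil_diag: "dil n n = q ^ n"
proof -
  have "dil n n = L (p n * pcompose (p n) [:0, q:])"
    by (simp add: dil_def mult.commute)
  also have "\<dots> = q ^ n"
    using coeff_p_pos[of n] by (subst L_p_times) (simp_all add: degree_dilated coeff_pcompose_linear)
  finally show ?thesis .
qed

text \<open>The Pearson equation moves the dilation from \<open>p (m + 4)\<close> to \<open>p m\<close>, at the price of the quartic
  factor. The product with that factor has degree \<open>m + 4\<close>, so only its leading coefficient counts.\<close>

lemma dil_far:
  "dil (m + 4) m = t / q * (c / q ^ m) * (a (m + 1) * a (m + 2) * a (m + 3) * a (m + 4))"
proof -
  \<comment> \<open>the inverse dilation of \<open>p m\<close>, so that the whole integrand becomes a dilated polynomial\<close>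
  define r where "r = pcompose (p m) [:0, 1 / q:]"
  have r: "pcompose r [:0, q:] = p m"
  proof -
    have "pcompose [:0, 1 / q:] [:0, q:] = [:0, 1:]"
      using q_pos by (simp add: pcompose_pCons)
    then show ?thesis
      unfolding r_def by (simp flip: pcompose_assoc)
  qed
  let ?S = "[:1, 0, - (1 + c), 0, c:]"
  have deg_r: "degree r = m"
    using q_pos by (simp add: r_def degree_pcompose degree_p)
  have "dil (m + 4) m = L (pcompose (p (m + 4) * r) [:0, q:])"
    by (simp add: dil_def pcompose_mult r)
  also have "\<dots> = t / q * L (p (m + 4) * (?S * r))"
    by (simp add: pearson mult.left_commute)
  also have "L (p (m + 4) * (?S * r)) = coeff (?S * r) (m + 4) / coeff (p (m + 4)) (m + 4)"
  proof (rule L_p_times)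
    have "degree (?S * r) \<le> degree ?S + degree r"
      by (rule degree_mult_le)
    also have "degree ?S \<le> 4"
      by (simp add: degree_pCons_eq_if)
    finally show "degree (?S * r) \<le> m + 4"
      using deg_r by simp
  qed
  also have "coeff (?S * r) (m + 4) = c * coeff r m"
    using deg_r by (simp add: coeff_eq_0 numeral_eq_Suc coeff_pCons)
  also have "coeff r m = coeff (p m) m / q ^ m"
    by (simp add: r_def coeff_pcompose_linear power_one_over)
  also have "coeff (p m) m
      = a (m + 1) * a (m + 2) * a (m + 3) * a (m + 4) * coeff (p (m + 4)) (m + 4)"
    using lead_p_step[of m] lead_p_step[of "m + 1"] lead_p_step[of "m + 2"] lead_p_step[of "m + 3"]
    by (simp add: numeral_eq_Suc)
  finally show ?thesis
    using coeff_p_pos[of "m + 4"] by (simp add: field_simps)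
qed

text \<open>Multiplying \<open>p n\<close> by \<open>x\<close> before dilating is \<open>q\<close> times multiplying by \<open>x\<close> afterwards, and the
  latter factor may be moved to \<open>p m\<close>. Both products expand by the three-term recurrence.\<close>

lemma dil_commute:
  "a (Suc n) * dil (Suc n) m + a n * dil (n - 1) m
     = q * (a (Suc m) * dil n (Suc m) + a m * dil n (m - 1))"
proof -
  let ?Q = "[:0, q:]"
  have 1: "pcompose ([:0, 1:] * p n) ?Q * p m
      = smult (a (Suc n)) (pcompose (p (Suc n)) ?Q * p m) + smult (a n) (pcompose (p (n - 1)) ?Q * p m)"
    unfolding recurrence by (simp add: pcompose_add pcompose_smult algebra_simps)
  have "pcompose ([:0, 1:] * p n) ?Q * p m = smult q (pcompose (p n) ?Q * ([:0, 1:] * p m))"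
    by (simp add: pcompose_mult pcompose_pCons algebra_simps)
  also have "\<dots> = smult q (smult (a (Suc m)) (pcompose (p n) ?Q * p (Suc m))
      + smult (a m) (pcompose (p n) ?Q * p (m - 1)))"
    unfolding recurrence by (simp add: algebra_simps)
  finally show ?thesis
    using arg_cong[OF 1, of L] by (simp add: L_add L_smult dil_def)
qed

definition y :: "nat \<Rightarrow> real" where
  "y n = (a n)\<^sup>2 * q / q ^ n"

lemma y_0: "y 0 = 0"
  by (simp add: y_def a_0)

lemma y_pos: "n \<ge> 1 \<Longrightarrow> y n > 0"
  using a_pos[of n] q_pos by (simp add: y_def)

lemma a_sq: "(a (Suc n))\<^sup>2 = q ^ n * y (Suc n)"
  using q_pos by (simp add: y_def)

text \<open>The second subdiagonal of the dilation matrix, normalised so that the relations below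
  involve the recurrence coefficients through their squares only.\<close>

definition u :: "nat \<Rightarrow> real" where
  "u m = a (m + 2) * dil (m + 2) m / a (m + 1)"

lemma dil_u: "a (m + 2) * dil (m + 2) m = a (m + 1) * u m"
  using a_pos[of "m + 1"] by (simp add: u_def)

lemma u_0: "u 0 = q\<^sup>2 - 1"
proof -
  have "a 1 * (u 0 + 1) = a 1 * q\<^sup>2"
    using dil_commute[of 1 0] dil_u[of 0] dil_diag[of 0] dil_diag[of 1]
    by (simp add: a_0 numeral_2_eq_2 algebra_simps)
  then show ?thesis
    using a_pos[of 1] by simp
qed

text \<open>The commutation relation at distance 1 from the diagonal, which links the diagonal and the
  second subdiagonal.\<close>

lemma u_step_near:
  "y (m + 2) * (u (m + 1) + q ^ (m + 1) - q ^ (m + 3)) = y (m + 1) * u m"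
proof -
  have "a (m + 3) * dil (m + 3) (m + 1) + a (m + 2) * q ^ (m + 1)
      = q * (a (m + 2) * q ^ (m + 2) + a (m + 1) * dil (m + 2) m)"
    using dil_commute[of "m + 2" "m + 1"] dil_diag[of "m + 1"] dil_diag[of "m + 2"]
    by (simp add: numeral_eq_Suc)
  moreover have "a (m + 3) * dil (m + 3) (m + 1) = a (m + 2) * u (m + 1)"
    using dil_u[of "m + 1"] by (simp add: numeral_eq_Suc)
  ultimately have "a (m + 2) * (u (m + 1) + q ^ (m + 1) - q ^ (m + 3)) = q * a (m + 1) * dil (m + 2) m"
    by (simp add: algebra_simps power_add power3_eq_cube power2_eq_square)
  then have "(a (m + 2))\<^sup>2 * (u (m + 1) + q ^ (m + 1) - q ^ (m + 3))
      = q * a (m + 1) * (a (m + 2) * dil (m + 2) m)"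
    by (simp add: power2_eq_square)
  also have "\<dots> = q * (a (m + 1))\<^sup>2 * u m"
    using dil_u[of m] by (simp add: power2_eq_square)
  finally have "q ^ (m + 1) * (y (m + 2) * (u (m + 1) + q ^ (m + 1) - q ^ (m + 3)))
      = q ^ (m + 1) * (y (m + 1) * u m)"
    using a_sq[of m] a_sq[of "m + 1"] by (simp add: mult.assoc)
  then show ?thesis
    using q_pos by simp
qed

text \<open>The commutation relation at distance 3 from the diagonal, which links the second and the
  fourth subdiagonal.\<close>

lemma u_step_far:
  "y (m + 3) * (u m + c * t * q ^ (m + 3) * y (m + 2) * y (m + 4))
     = y (m + 2) * (u (m + 1) + c * t * q ^ (m + 1) * y m * y (m + 3))"
proof -
  define X where "X = c * t / q ^ (m + 1)"
  have A: "a (m + 1) > 0" "a (m + 2) > 0" "a (m + 3) > 0" "a (m + 4) > 0"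
    using a_pos by simp_all
  have "a (m + 4) * dil (m + 4) m + a (m + 3) * dil (m + 2) m
      = q * (a (m + 1) * dil (m + 3) (m + 1) + a m * dil (m + 3) (m - 1))"
    using dil_commute[of "m + 3" m] by (simp add: numeral_eq_Suc)
  moreover have "dil (m + 4) m = X * (a (m + 1) * a (m + 2) * a (m + 3) * a (m + 4))"
    by (simp add: dil_far X_def mult_ac)
  moreover have "a m * dil (m + 3) (m - 1)
      = X * q * (a m)\<^sup>2 * (a (m + 1) * a (m + 2) * a (m + 3))"
  proof (cases m)
    case 0
    then show ?thesis by (simp add: a_0)
  next
    case (Suc k)
    then show ?thesis
      using dil_far[of k] q_pos by (simp add: X_def numeral_eq_Suc power2_eq_square)
  qed
  moreover have "dil (m + 2) m = a (m + 1) * u m / a (m + 2)"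
    using dil_u[of m] A by (simp add: field_simps)
  moreover have "dil (m + 3) (m + 1) = a (m + 2) * u (m + 1) / a (m + 3)"
    using dil_u[of "m + 1"] A by (simp add: field_simps numeral_eq_Suc)
  ultimately have "a (m + 4) * (X * (a (m + 1) * a (m + 2) * a (m + 3) * a (m + 4)))
      + a (m + 3) * (a (m + 1) * u m / a (m + 2))
      = q * (a (m + 1) * (a (m + 2) * u (m + 1) / a (m + 3))
          + X * q * (a m)\<^sup>2 * (a (m + 1) * a (m + 2) * a (m + 3)))"
    by simp
  then have "a (m + 1) * (X * (a (m + 2))\<^sup>2 * (a (m + 3))\<^sup>2 * (a (m + 4))\<^sup>2 + (a (m + 3))\<^sup>2 * u m)
      = a (m + 1) * (q * ((a (m + 2))\<^sup>2 * u (m + 1))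
          + X * q\<^sup>2 * (a m)\<^sup>2 * (a (m + 2))\<^sup>2 * (a (m + 3))\<^sup>2)"
    using A(2-4) by (simp add: field_simps power2_eq_square)
  then have "X * (a (m + 2))\<^sup>2 * (a (m + 3))\<^sup>2 * (a (m + 4))\<^sup>2 + (a (m + 3))\<^sup>2 * u m
      = q * ((a (m + 2))\<^sup>2 * u (m + 1)) + X * q\<^sup>2 * (a m)\<^sup>2 * (a (m + 2))\<^sup>2 * (a (m + 3))\<^sup>2"
    using A(1) by simp
  moreover have "(a (m + 2))\<^sup>2 = q ^ (m + 1) * y (m + 2)"
      "(a (m + 3))\<^sup>2 = q ^ (m + 2) * y (m + 3)" "(a (m + 4))\<^sup>2 = q ^ (m + 3) * y (m + 4)"
    using a_sq[of "m + 1"] a_sq[of "m + 2"] a_sq[of "m + 3"] by (simp_all add: numeral_eq_Suc)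
  moreover have "(a m)\<^sup>2 * q = q ^ m * y m"
    using q_pos by (simp add: y_def)
  then have "X * q\<^sup>2 * (a m)\<^sup>2 = c * t * y m"
    using q_pos by (simp add: X_def power2_eq_square field_simps)
  moreover have "X * q ^ (m + 1) = c * t"
    using q_pos by (simp add: X_def)
  ultimately have "(c * t) * y (m + 2) * (q ^ (m + 2) * y (m + 3)) * (q ^ (m + 3) * y (m + 4))
      + q ^ (m + 2) * y (m + 3) * u m
      = q * (q ^ (m + 1) * y (m + 2) * u (m + 1))
        + c * t * y m * (q ^ (m + 1) * y (m + 2)) * (q ^ (m + 2) * y (m + 3))"
    by (metis mult.assoc)
  then have "q ^ (m + 2) * (y (m + 3) * (u m + c * t * q ^ (m + 3) * y (m + 2) * y (m + 4)))
      = q ^ (m + 2) * (y (m + 2) * (u (m + 1) + c * t * q ^ (m + 1) * y m * y (m + 3)))"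
    by (simp add: algebra_simps power_add power2_eq_square)
  then show ?thesis
    using q_pos by simp
qed

text \<open>A first integral of the two relations: eliminating \<open>y (m + 2) * u (m + 1)\<close> between
  \<open>u_step_far\<close> at \<open>m\<close> and \<open>u_step_near\<close> at \<open>m + 1\<close> leaves a common factor \<open>y (m + 3)\<close>, and what
  remains compares the same expression at \<open>m\<close> and \<open>m + 2\<close>.\<close>

definition invar :: "nat \<Rightarrow> real" where
  "invar m = q ^ (m + 2) + c * t * q ^ (m + 1) * y (m + 2) * y m - u m"

lemma invar_period: "invar (m + 2) = invar m"
proof -
  have "y (m + 3) * (u (m + 2) + q ^ (m + 2) - q ^ (m + 4)) = y (m + 2) * u (m + 1)"
    using u_step_near[of "m + 1"] by (simp add: numeral_eq_Suc)
  with u_step_far[of m] have "y (m + 3) * invar (m + 2) = y (m + 3) * invar m"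
    unfolding invar_def by (simp add: algebra_simps numeral_eq_Suc)
  then show ?thesis
    using y_pos[of "m + 3"] by simp
qed

lemma x_p_0: "[:0, 1:] * p 0 = smult (a 1) (p 1)"
  using recurrence[of 0] by (simp add: a_0)

lemma x_p_1: "[:0, 1:] * p 1 = smult (a 2) (p 2) + smult (a 1) (p 0)"
  using recurrence[of 1] by (simp add: numeral_2_eq_2)

lemma x_p_2: "[:0, 1:] * p 2 = smult (a 3) (p 3) + smult (a 2) (p 1)"
  using recurrence[of 2] by (simp add: numeral_3_eq_3 numeral_2_eq_2)

text \<open>The hypothesis holds for \<open>n = 0\<close> and \<open>n = 1\<close>, where \<open>p n\<close> is a monomial. The Pearson equation
  for its square then becomes a relation between the squared norms of \<open>x p_n\<close> and \<open>x^2 p_n\<close>, which the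
  three-term recurrence evaluates; this provides the initial values.\<close>

lemma pearson_p_square:
  assumes "pcompose (p n) [:0, q:] = smult (q ^ n) (p n)"
  shows "q * q ^ (2 * n) = t * (1 - (1 + c) * L (([:0, 1:] * p n) * ([:0, 1:] * p n))
    + c * L (([:0, 1:] * ([:0, 1:] * p n)) * ([:0, 1:] * ([:0, 1:] * p n))))"
proof -
  have S: "[:1, 0, - (1 + c), 0, c:] * (p n * p n) = p n * p n
      - smult (1 + c) (([:0, 1:] * p n) * ([:0, 1:] * p n))
      + smult c (([:0, 1:] * ([:0, 1:] * p n)) * ([:0, 1:] * ([:0, 1:] * p n)))"
    by (rule poly_eq_poly_eq_iff[THEN iffD1], rule ext) (simp add: algebra_simps)
  have "q ^ n * (q ^ n * 1) = L (pcompose (p n * p n) [:0, q:])"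
    by (simp add: pcompose_mult assms L_smult ortho)
  also have "\<dots> = t / q * L ([:1, 0, - (1 + c), 0, c:] * (p n * p n))"
    by (rule pearson)
  also have "\<dots> = t / q * (1 - (1 + c) * L (([:0, 1:] * p n) * ([:0, 1:] * p n))
    + c * L (([:0, 1:] * ([:0, 1:] * p n)) * ([:0, 1:] * ([:0, 1:] * p n))))"
    unfolding S L_add L_diff L_smult by (simp add: ortho)
  finally show ?thesis
    using q_pos by (simp add: field_simps flip: power_add mult_2)
qed

lemma pearson_moment_0: "q = t * (1 - (1 + c) * y 1 + c * y 1 * (y 1 + q * y 2))"
proof -
  obtain k where k: "p 0 = [:k:]"
    using degree_p[of 0] degree_0_id[of "p 0"] by metis
  have xx: "[:0, 1:] * ([:0, 1:] * p 0) = smult (a 1 * a 2) (p 2) + smult (a 1 * a 1) (p 0)"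
    unfolding x_p_0 mult_smult_right x_p_1 by (simp add: smult_add_right)
  have dil_p0: "pcompose (p 0) [:0, q:] = smult (q ^ 0) (p 0)"
    by (simp add: k)
  have "q * q ^ (2 * 0) = t * (1 - (1 + c) * (a 1 * a 1) + c * (a 1 * a 2 * (a 1 * a 2) + a 1 * a 1 * (a 1 * a 1)))"
    unfolding pearson_p_square[OF dil_p0] xx unfolding x_p_0
    by (simp add: L_add L_smult ortho distrib_left distrib_right)
  moreover have "a 1 * a 1 = y 1" "a 2 * a 2 = q * y 2"
    using a_sq[of 0] a_sq[of 1] by (simp_all add: power2_eq_square numeral_2_eq_2)
  moreover have "a 1 * a 2 * (a 1 * a 2) = (a 1 * a 1) * (a 2 * a 2)"
    by simp
  ultimately have "q * q ^ (2 * 0)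
      = t * (1 - (1 + c) * y 1 + c * (y 1 * (q * y 2) + y 1 * y 1))"
    by (simp only:)
  then show ?thesis
    by (simp add: algebra_simps)
qed

lemma pearson_moment_1:
  "q ^ 3 = t * (1 - (1 + c) * (y 1 + q * y 2) + c * ((y 1 + q * y 2)\<^sup>2 + q ^ 3 * y 2 * y 3))"
proof -
  obtain k where k: "p 0 = [:k:]"
    using degree_p[of 0] degree_0_id[of "p 0"] by metis
  have "smult (a 1) (pcompose (p 1) [:0, q:]) = pcompose ([:0, 1:] * p 0) [:0, q:]"
    by (simp only: x_p_0 pcompose_smult)
  also have "\<dots> = smult q ([:0, 1:] * p 0)"
    by (simp add: k pcompose_pCons)
  also have "\<dots> = smult (a 1) (smult q (p 1))"
    unfolding x_p_0 by (simp add: mult.commute)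
  finally have dil_p1: "pcompose (p 1) [:0, q:] = smult (q ^ 1) (p 1)"
    using a_pos[of 1] by (simp add: poly_eq_iff)
  have xx: "[:0, 1:] * ([:0, 1:] * p 1) = smult (a 2 * a 3) (p 3) + smult (a 2 * a 2 + a 1 * a 1) (p 1)"
    unfolding x_p_1 distrib_left mult_smult_right x_p_2 x_p_0 by (simp add: smult_add_right smult_add_left)
  have "q * q ^ (2 * 1) = t * (1 - (1 + c) * (a 2 * a 2 + a 1 * a 1)
      + c * (a 2 * a 3 * (a 2 * a 3) + (a 2 * a 2 + a 1 * a 1) * (a 2 * a 2 + a 1 * a 1)))"
    unfolding pearson_p_square[OF dil_p1] xx unfolding x_p_1
    by (simp add: L_add L_smult ortho distrib_left distrib_right)
  moreover have "a 1 * a 1 = y 1" "a 2 * a 2 = q * y 2"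
    using a_sq[of 0] a_sq[of 1] by (simp_all add: power2_eq_square numeral_2_eq_2)
  moreover have "a 3 * a 3 = q * q * y 3"
    using a_sq[of 2] by (simp add: power2_eq_square)
  moreover have "a 2 * a 3 * (a 2 * a 3) = (a 2 * a 2) * (a 3 * a 3)"
    by simp
  ultimately have "q * q ^ (2 * 1) = t * (1 - (1 + c) * (q * y 2 + y 1)
      + c * (q * y 2 * (q * q * y 3) + (q * y 2 + y 1) * (q * y 2 + y 1)))"
    by (simp only:)
  then show ?thesis
    by (simp add: power2_eq_square power3_eq_cube algebra_simps)
qed

lemma invar_0: "invar 0 = 1"
  by (simp add: invar_def y_0 u_0 power2_eq_square)

lemma invar_1: "invar 1 = t"
proof -
  have u1: "y 2 * (u 1 + q - q ^ 3) = y 1 * (q\<^sup>2 - 1)"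
    using u_step_near[of 0] by (simp add: u_0 numeral_eq_Suc)
  \<comment> \<open>in this combination of the two moment relations the right-hand side keeps only terms with a
    factor \<open>y 2\<close>\<close>
  have "(y 1 + q * y 2) * q - y 1 * q ^ 3
      = (y 1 + q * y 2) * (t * (1 - (1 + c) * y 1 + c * y 1 * (y 1 + q * y 2)))
        - y 1 * (t * (1 - (1 + c) * (y 1 + q * y 2) + c * ((y 1 + q * y 2)\<^sup>2 + q ^ 3 * y 2 * y 3)))"
    using pearson_moment_0 pearson_moment_1 by simp
  also have "\<dots> = q * (t * y 2 - c * t * q\<^sup>2 * y 1 * y 2 * y 3)"
    by (simp add: algebra_simps power2_eq_square power3_eq_cube)
  finally have "q * (y 1 + q * y 2 - q\<^sup>2 * y 1) = q * (t * y 2 - c * t * q\<^sup>2 * y 1 * y 2 * y 3)"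
    by (simp add: algebra_simps power2_eq_square power3_eq_cube)
  then have "y 1 + q * y 2 - q\<^sup>2 * y 1 = t * y 2 - c * t * q\<^sup>2 * y 1 * y 2 * y 3"
    using q_pos by simp
  with u1 have "y 2 * invar 1 = y 2 * t"
    by (simp add: invar_def algebra_simps numeral_3_eq_3 numeral_2_eq_2)
  then show ?thesis
    using y_pos[of 2] by simp
qed

lemma invar_eq: "invar m = (if even m then 1 else t)"
proof (induction m rule: induct_nat_012)
  case (ge2 n)
  then show ?case using invar_period[of n] by simp
qed (simp_all add: invar_0 invar_1[simplified])

text \<open>The case \<open>n = 1\<close> is the Pearson equation for \<open>p_0^2\<close>. For the step, write \<open>X k\<close> for
  \<open>1 - c t y_k y_(k-1)\<close>. Replacing \<open>u\<close> by its value in \<open>u_step_near\<close> gives a relation between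
  \<open>X (m + 3)\<close> and \<open>X (m + 1)\<close>; multiplied by \<open>X (m + 2)\<close>, it expresses \<open>y (m + 1)\<close> times the left-hand
  side for \<open>m + 2\<close> by \<open>y (m + 2)\<close> times the one for \<open>m + 1\<close> and an explicit correction that depends on
  the parity of \<open>m\<close>.\<close>

theorem recurrence_relation:
  assumes "n \<ge> 1"
  shows "q ^ n * (1 - c * t * y n * y (n - 1)) * (1 - c * t * y n * y (n + 1))
    = (if even n then (1 - t * y n) * (1 - c * t * y n) else t * (1 - y n) * (1 - c * y n))"
  using assms
proof (induction n rule: nat_induct_at_least)
  case base
  then show ?case
    using pearson_moment_0 by (simp add: y_0 algebra_simps numeral_2_eq_2)
next
  case (Suc n)
  define m where "m = n - 1"
  have n: "n = m + 1" using Suc.hyps by (simp add: m_def)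
  define X where "X k = 1 - c * t * y k * y (k - 1)" for k
  define R where "R k = (if even k then (1 - t * y k) * (1 - c * t * y k) else t * (1 - y k) * (1 - c * y k))" for k
  have IH: "q ^ (m + 1) * X (m + 1) * X (m + 2) = R (m + 1)"
    using Suc.IH by (simp add: X_def R_def n mult_ac)
  have u1: "u (m + 1) = q ^ (m + 3) + c * t * q ^ (m + 2) * y (m + 3) * y (m + 1) - invar (m + 1)"
    by (simp add: invar_def numeral_eq_Suc)
  have u0: "u m = q ^ (m + 2) + c * t * q ^ (m + 1) * y (m + 2) * y m - invar m"
    by (simp add: invar_def)
  have "y (m + 2) * (q ^ (m + 1) + c * t * q ^ (m + 2) * y (m + 3) * y (m + 1) - invar (m + 1))
      = y (m + 1) * (q ^ (m + 2) + c * t * q ^ (m + 1) * y (m + 2) * y m - invar m)"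
    using u_step_near[of m] unfolding u1 u0 by (simp add: algebra_simps)
  then have third: "q ^ (m + 2) * y (m + 1) * X (m + 3)
      = q ^ (m + 1) * y (m + 2) * X (m + 1) - (y (m + 2) * invar (m + 1) - y (m + 1) * invar m)"
    by (simp add: X_def algebra_simps numeral_eq_Suc)
  have "y (m + 1) * (q ^ (m + 2) * X (m + 2) * X (m + 3)) = X (m + 2) * (q ^ (m + 2) * y (m + 1) * X (m + 3))"
    by simp
  also have "\<dots> = y (m + 2) * (q ^ (m + 1) * X (m + 1) * X (m + 2))
      - X (m + 2) * (y (m + 2) * invar (m + 1) - y (m + 1) * invar m)"
    unfolding third by (simp add: algebra_simps)
  also have "\<dots> = y (m + 1) * R (m + 2)"
    unfolding IH by (simp add: R_def X_def invar_eq algebra_simps)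
  finally have "q ^ (m + 2) * X (m + 2) * X (m + 3) = R (m + 2)"
    using y_pos[of "m + 1"] by simp
  then show ?case
    by (simp add: n X_def R_def numeral_eq_Suc mult_ac)
qed

end

section \<open>The functional given by the weight\<close>

lemma qpoch_inf_rec:
  assumes "0 < q" and "q < 1"
  shows "qpoch_inf b q = (1 - b) * qpoch_inf (b * q) q"
proof -
  have "summable (\<lambda>j. norm (1 - b * q ^ j - 1))" for b
    using assms by (simp add: abs_mult summable_mult summable_geometric)
  then have "convergent_prod (\<lambda>j. 1 - b * q ^ j)" for b
    by (simp add: abs_convergent_prod_conv_summable abs_convergent_prod_imp_convergent_prod)
  then have conv: "(\<lambda>n. \<Prod>j\<le>n. 1 - b * q ^ j) \<longlonglongrightarrow> qpoch_inf b q" for b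
    unfolding qpoch_inf_def by (rule convergent_prod_LIMSEQ)
  have "(\<lambda>n. (1 - b) * (\<Prod>j\<le>n. 1 - b * q * q ^ j)) \<longlonglongrightarrow> (1 - b) * qpoch_inf (b * q) q"
    by (intro tendsto_mult_left conv)
  moreover have "(1 - b) * (\<Prod>j\<le>n. 1 - b * q * q ^ j) = (\<Prod>j\<le>Suc n. 1 - b * q ^ j)" for n
    unfolding prod.atMost_Suc_shift by (simp add: mult.assoc)
  ultimately show ?thesis
    using LIMSEQ_unique[OF LIMSEQ_Suc[OF conv[of b]]] by simp
qed

text \<open>Dilation moves each of the infinite products by one factor.\<close>

lemma qweight_dilate:
  assumes "0 < q" and "q < 1"
  shows "qweight q \<alpha> c x
    = q powr (- \<alpha>) * ((1 - (q * x)\<^sup>2) * (1 - c * (q * x)\<^sup>2)) * qweight q \<alpha> c (q * x)"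
proof -
  have q2: "0 < q\<^sup>2" "q\<^sup>2 < 1"
    using assms by (auto simp: power_less_one_iff)
  have "qpoch_inf (q\<^sup>2 * x\<^sup>2) (q\<^sup>2) = (1 - (q * x)\<^sup>2) * qpoch_inf (q\<^sup>2 * (q * x)\<^sup>2) (q\<^sup>2)"
    by (subst qpoch_inf_rec[OF q2]) (simp add: power_mult_distrib mult_ac)
  moreover have "qpoch_inf (c * q\<^sup>2 * x\<^sup>2) (q\<^sup>2)
      = (1 - c * (q * x)\<^sup>2) * qpoch_inf (c * q\<^sup>2 * (q * x)\<^sup>2) (q\<^sup>2)"
    by (subst qpoch_inf_rec[OF q2]) (simp add: power_mult_distrib mult_ac)
  moreover have "\<bar>x\<bar> powr \<alpha> = q powr (- \<alpha>) * \<bar>q * x\<bar> powr \<alpha>"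
    using assms by (simp add: abs_mult powr_mult powr_minus field_simps)
  ultimately show ?thesis
    by (simp add: qweight_def)
qed

lemma qweight_minus: "qweight q \<alpha> c (- x) = qweight q \<alpha> c x"
  by (simp add: qweight_def)

text \<open>A ratio test: by \<open>qweight_dilate\<close> the quotient of consecutive terms tends to
  \<open>q powr (\<alpha> + 1)\<close>, so the infinite products need not be estimated.\<close>

lemma summable_qweight_lattice:
  assumes "0 < q" and "q < 1" and "\<alpha> > -1"
  shows "summable (\<lambda>k. \<bar>qweight q \<alpha> c (q ^ k) * q ^ k\<bar>)"
proof -
  define W where "W k = \<bar>qweight q \<alpha> c (q ^ k) * q ^ k\<bar>" for k
  define D where "D k = (1 - (q ^ Suc k)\<^sup>2) * (1 - c * (q ^ Suc k)\<^sup>2)" for k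
  define s where "s = q powr (\<alpha> + 1)"
  have s: "0 < s" "s < 1"
    using assms mult_pos_neg[of "\<alpha> + 1" "ln q"] by (simp_all add: s_def powr_def)
  have D: "\<bar>D k\<bar> * W (Suc k) = s * W k" for k
  proof -
    have "qweight q \<alpha> c (q ^ k) = q powr (- \<alpha>) * D k * qweight q \<alpha> c (q ^ Suc k)"
      using qweight_dilate[OF assms(1,2), of \<alpha> c "q ^ k"] by (simp add: D_def)
    then show ?thesis
      using assms(1) by (simp add: W_def s_def abs_mult powr_add powr_minus)
  qed
  \<comment> \<open>with \<open>D k > sqrt s\<close> the ratio \<open>s / D k\<close> is below \<open>sqrt s < 1\<close>\<close>
  have "D \<longlonglongrightarrow> (1 - 0\<^sup>2) * (1 - c * 0\<^sup>2)"
    unfolding D_def using assms by (intro tendsto_intros LIMSEQ_Suc LIMSEQ_realpow_zero) auto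
  then have "eventually (\<lambda>k. D k > sqrt s) sequentially"
    using s by (intro order_tendstoD) auto
  then obtain N where N: "\<And>k. k \<ge> N \<Longrightarrow> D k > sqrt s"
    by (auto simp: eventually_sequentially)
  have "summable W"
  proof (rule summable_ratio_test)
    show "sqrt s < 1" using s by simp
    fix k assume "k \<ge> N"
    then have "sqrt s * W (Suc k) \<le> \<bar>D k\<bar> * W (Suc k)"
      using N[of k] by (intro mult_right_mono) (auto simp: W_def)
    also have "\<dots> = sqrt s * (sqrt s * W k)"
      using D[of k] s by simp
    finally show "norm (W (Suc k)) \<le> sqrt s * norm (W k)"
      using s by (simp add: W_def)
  qed
  then show ?thesis
    by (simp add: W_def[abs_def])
qed

lemma summable_poly_qweight:
  assumes "0 < q" and "q < 1" and "\<alpha> > -1"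
  shows "summable (\<lambda>k. poly f (q ^ k) * qweight q \<alpha> c (q ^ k) * q ^ k)"
    and "summable (\<lambda>k. poly f (- (q ^ k)) * qweight q \<alpha> c (- (q ^ k)) * q ^ k)"
proof -
  have "bounded (poly f ` {-1..1})"
    by (intro compact_imp_bounded compact_continuous_image continuous_intros) auto
  then obtain B where "\<forall>z\<in>poly f ` {-1..1}. norm z \<le> B"
    unfolding bounded_iff by blast
  then have B: "\<bar>poly f x\<bar> \<le> B" if "\<bar>x\<bar> \<le> 1" for x
    using that by (simp add: abs_le_iff)
  have dom: "summable (\<lambda>k. B * \<bar>qweight q \<alpha> c (q ^ k) * q ^ k\<bar>)"
    by (intro summable_mult summable_qweight_lattice assms)
  have q_le: "\<bar>q ^ k\<bar> \<le> 1" for k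
    using assms by (simp add: power_le_one)
  show "summable (\<lambda>k. poly f (q ^ k) * qweight q \<alpha> c (q ^ k) * q ^ k)"
    using B[OF q_le]
    by (intro summable_comparison_test'[OF dom]) (simp add: abs_mult mult.assoc mult_right_mono)
  show "summable (\<lambda>k. poly f (- (q ^ k)) * qweight q \<alpha> c (- (q ^ k)) * q ^ k)"
    using B[of "- (q ^ k)" for k] q_le
    by (intro summable_comparison_test'[OF dom])
      (simp add: abs_mult mult.assoc mult_right_mono qweight_minus)
qed

lemma q_integral_add:
  assumes "summable (\<lambda>k. f (q ^ k) * q ^ k)" "summable (\<lambda>k. f (- (q ^ k)) * q ^ k)"
    and "summable (\<lambda>k. g (q ^ k) * q ^ k)" "summable (\<lambda>k. g (- (q ^ k)) * q ^ k)"
  shows "q_integral q (\<lambda>x. f x + g x) = q_integral q f + q_integral q g"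
  unfolding q_integral_def distrib_right
  by (simp add: suminf_add[OF assms(1,3), symmetric] suminf_add[OF assms(2,4), symmetric] distrib_left)

lemma q_integral_cmult:
  assumes "summable (\<lambda>k. f (q ^ k) * q ^ k)" "summable (\<lambda>k. f (- (q ^ k)) * q ^ k)"
  shows "q_integral q (\<lambda>x. b * f x) = b * q_integral q f"
  unfolding q_integral_def mult.assoc
  by (simp add: suminf_mult[OF assms(1)] suminf_mult[OF assms(2)] distrib_left)

lemma summable_lattice_dilate:
  fixes h :: "real \<Rightarrow> real"
  assumes "q \<noteq> 0" and "summable (\<lambda>k. h (q ^ k) * q ^ k)"
  shows "summable (\<lambda>k. h (q * q ^ k) * q ^ k)"
proof -
  have "summable (\<lambda>k. h (q ^ Suc k) * q ^ Suc k)"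
    using assms(2) by (subst summable_Suc_iff)
  then show ?thesis
    using summable_mult[of "\<lambda>k. h (q ^ Suc k) * q ^ Suc k" "1 / q"] assms(1)
    by (simp add: mult_ac)
qed

text \<open>Dilation by \<open>q\<close> shifts each half of the lattice by one point. No boundary term appears
  because the integrand vanishes at the end points.\<close>

lemma q_integral_dilate:
  assumes "q \<noteq> 0"
    and "summable (\<lambda>k. g (q ^ k) * q ^ k)" "summable (\<lambda>k. g (- (q ^ k)) * q ^ k)"
    and "g 1 = 0" "g (-1) = 0"
  shows "q_integral q (\<lambda>x. g (q * x)) = q_integral q g / q"
proof -
  have "(\<Sum>k. h (q * q ^ k) * q ^ k) = (\<Sum>k. h (q ^ k) * q ^ k) / q"
    if h: "summable (\<lambda>k. h (q ^ k) * q ^ k)" "h 1 = 0" for h :: "real \<Rightarrow> real"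
    using suminf_mult[OF summable_lattice_dilate[OF assms(1) h(1)], of q]
      suminf_split_head[OF h(1)] assms(1) h(2)
    by (simp add: field_simps)
  from this[of g] this[of "\<lambda>x. g (- x)"] assms show ?thesis
    by (simp add: q_integral_def add_divide_distrib)
qed

text \<open>The factors \<open>1 - x^2\<close> and \<open>1 - c x^2\<close> picked up by the weight under dilation form the
  quartic; it vanishes at \<open>1\<close> and \<open>-1\<close>, which is what the change of variable needs.\<close>

lemma q_pearson_qweight:
  assumes "0 < q" and "q < 1" and "\<alpha> > -1"
  shows "q_integral q (\<lambda>x. poly (pcompose f [:0, q:]) x * qweight q \<alpha> c x)
    = q powr (- \<alpha>) / q *
      q_integral q (\<lambda>x. poly ([:1, 0, - (1 + c), 0, c:] * f) x * qweight q \<alpha> c x)"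
proof -
  define g where "g = (\<lambda>x. poly ([:1, 0, - (1 + c), 0, c:] * f) x * qweight q \<alpha> c x)"
  have S: "summable (\<lambda>k. g (q ^ k) * q ^ k)" "summable (\<lambda>k. g (- (q ^ k)) * q ^ k)"
    unfolding g_def by (rule summable_poly_qweight[OF assms])+
  have eq: "poly (pcompose f [:0, q:]) x * qweight q \<alpha> c x = q powr (- \<alpha>) * g (q * x)" for x
    unfolding g_def qweight_dilate[OF assms(1,2), of \<alpha> c x]
    by (simp add: poly_pcompose algebra_simps power2_eq_square)
  have "q_integral q (\<lambda>x. q powr (- \<alpha>) * g (q * x)) = q powr (- \<alpha>) * q_integral q (\<lambda>x. g (q * x))"
    using summable_lattice_dilate[OF _ S(1)] summable_lattice_dilate[of q "\<lambda>x. g (- x)"] S(2) assms(1)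
    by (intro q_integral_cmult) simp_all
  also have "q_integral q (\<lambda>x. g (q * x)) = q_integral q g / q"
    using assms S by (intro q_integral_dilate) (simp_all add: g_def algebra_simps)
  finally show ?thesis
    unfolding eq g_def by simp
qed

theorem mainTheorem2:
  fixes q \<alpha> c :: real
    and p :: "nat \<Rightarrow> real poly"
    and a y :: "nat \<Rightarrow> real"
  assumes "0 < q" and "q < 1" and "\<alpha> > -1" and "c \<le> 0"
    and "orthonormal_polys q (qweight q \<alpha> c) p"
    and "recurrence_coeffs p a"
    and "y 0 = 0"
    and "\<And>n. n \<ge> 1 \<Longrightarrow> y n = (a n)\<^sup>2 * q powi (1 - int n)"
  shows "\<forall>n\<ge>1.
    q powr (real n - \<alpha>) * (- c * y n * y (n + 1) + q powr \<alpha>) * (- c * y n * y (n - 1) + q powr \<alpha>) =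
      (if even n
       then (q powr \<alpha> - y n) * (q powr \<alpha> - c * y n) * q powr (- \<alpha>)
       else (1 - y n) * (1 - c * y n))"
proof (intro allI impI)
  fix n :: nat
  assume n: "n \<ge> 1"
  define t where "t = q powr (- \<alpha>)"
  have t: "t > 0" "q powr \<alpha> = 1 / t" "q powr (real n - \<alpha>) = q ^ n * t"
    using assms(1) by (simp_all add: t_def powr_minus field_simps powr_diff powr_realpow)
  define L where "L f = q_integral q (\<lambda>x. poly f x * qweight q \<alpha> c x)" for f
  \<comment> \<open>at index 0 the recurrence of the locale needs the coefficient 0\<close>
  define b where "b n = (if n = 0 then 0 else a n)" for n :: nat
  note sums = summable_poly_qweight[OF assms(1-3)]
  interpret q_pearson_functional q t c L p b
  proof
    show "q > 0" "t > 0" using assms(1) t by simp_all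
    show "L (f + g) = L f + L g" for f g
      unfolding L_def poly_add distrib_right by (intro q_integral_add sums)
    show "L (smult k f) = k * L f" for k f
      unfolding L_def poly_smult mult.assoc[of k] by (intro q_integral_cmult sums)
    show "degree (p n) = n" "lead_coeff (p n) > 0" for n
      using assms(5) unfolding orthonormal_polys_def by blast+
    show "L (p n * p m) = (if n = m then 1 else 0)" for n m
      using assms(5) by (auto simp: orthonormal_polys_def L_def)
    show "b 0 = 0" by (simp add: b_def)
    show "b n > 0" if "n \<ge> 1" for n
      using assms(6) that by (simp add: b_def recurrence_coeffs_def)
    show "[:0, 1:] * p n = smult (b (Suc n)) (p (Suc n)) + smult (b n) (p (n - 1))" for n
      using assms(6) by (cases n) (simp_all add: recurrence_coeffs_def b_def)
    show "L (pcompose f [:0, q:]) = t / q * L ([:1, 0, - (1 + c), 0, c:] * f)" for f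
      unfolding L_def t_def by (rule q_pearson_qweight[OF assms(1-3)])
  qed
  have y_eq: "local.y k = y k" for k
  proof (cases k)
    case 0
    then show ?thesis using assms(7) y_0 by simp
  next
    case (Suc j)
    then show ?thesis
      using assms(8)[of k] assms(1) by (simp add: y_def b_def power_int_minus divide_inverse)
  qed
  have "q ^ n * t * (- c * y n * y (n + 1) + 1 / t) * (- c * y n * y (n - 1) + 1 / t)
      = q ^ n * (1 - c * t * y n * y (n - 1)) * (1 - c * t * y n * y (n + 1)) / t"
    using t(1) by (simp add: field_simps)
  also have "\<dots> = (if even n then (1 - t * y n) * (1 - c * t * y n) else t * (1 - y n) * (1 - c * y n)) / t"
    using recurrence_relation[OF n] unfolding y_eq by simp
  finally have rel: "q ^ n * t * (- c * y n * y (n + 1) + 1 / t) * (- c * y n * y (n - 1) + 1 / t) = \<dots>" .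
  show "q powr (real n - \<alpha>) * (- c * y n * y (n + 1) + q powr \<alpha>) * (- c * y n * y (n - 1) + q powr \<alpha>) =
      (if even n
       then (q powr \<alpha> - y n) * (q powr \<alpha> - c * y n) * q powr (- \<alpha>)
       else (1 - y n) * (1 - c * y n))"
    unfolding t(2,3) t_def[symmetric] rel using t(1) by (simp add: field_simps)
qed

end
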